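(* Let $\mu\in\Lambda$ and let $d\in\mathbb{Z}_{>0}$ satisfy $\mu_3\le p^d$. For $\theta,\theta'\in\mathrm{Der}_S$, the following are equivalent: (i) $\{\theta,\theta'\}$ is a basis for $D(\mathcal{A},\mu)$; (ii) $\{\Psi_d(\theta),\Psi_d(\theta')\}$ is a basis for $D(\mathcal{A},\mu+(p^d,p^d,0))$. Furthermore, $\Delta(\mu)=\Delta(\mu+(p^d,p^d,0))$.
   Context: Let $p$ be a prime, $\mathbb{F}=\mathbb{F}_p$, $S=\mathbb{F}[x,y]$, $\mathrm{Der}_S=S\partial_x\oplus S\partial_y$, where a derivation $\theta=f\partial_x+g\partial_y$ acts by $\theta(x)=f$, $\theta(y)=g$. Let $\mathcal{A}=\{H_1,H_2,H_3\}$ with $H_1=\ker x$, $H_2=\ker y$, $H_3=\ker(x+y)$, $\alpha_1=x,\alpha_2=y,\alpha_3=x+y$. For $\mu=(\mu_1,\mu_2,\mu_3)\in\Lambda\coloneqq\mathbb{Z}_{\ge0}^3$, $D(\mathcal{A},\mu)=\{\theta\in\mathrm{Der}_S:\theta(\alpha_i)\in\alpha_i^{\mu_i}S,\ i=1,2,3\}$; it is a free $S$-module of rank 2 with a homogeneous basis whose degrees (the exponents) are unique up to order; $\Delta(\mu)$ is the absolute difference of the two exponents. For $d>0$, $\Psi_d:\mathrm{Der}_S\to\mathrm{Der}_S$ is defined by $\Psi_d(\theta)=\theta(x)x^{p^d}\partial_x-\theta(y)y^{p^d}\partial_y$. *)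

theory Defs
  imports
    "Berlekamp_Zassenhaus.Finite_Field"
    "HOL-Computational_Algebra.Polynomial"
    "HOL-Library.Product_Plus"
begin

text \<open>
  The field with \<open>p\<close> elements is \<open>'p mod_ring\<close> with \<open>p = CARD('p)\<close>, where the class
  \<open>prime_card\<close> says that \<open>p\<close> is prime.  The ring \<open>S = F[x,y]\<close> is rendered as \<open>F[x][y]\<close>: the
  outer polynomial variable is \<open>y\<close>, the inner one is \<open>x\<close>.
\<close>

type_synonym 'p bipoly = "'p mod_ring poly poly"

definition var_x :: "'p::prime_card bipoly" where
  "var_x = [:[:0, 1:]:]"

definition var_y :: "'p::prime_card bipoly" where
  "var_y = [:0, 1:]"

definition partial_x :: "'p::prime_card bipoly \<Rightarrow> 'p bipoly" where
  "partial_x h = map_poly pderiv h"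

definition partial_y :: "'p::prime_card bipoly \<Rightarrow> 'p bipoly" where
  "partial_y h = pderiv h"

definition homogeneous :: "nat \<Rightarrow> 'p::prime_card bipoly \<Rightarrow> bool" where
  "homogeneous n h \<longleftrightarrow> (\<forall>i j. coeff (coeff h j) i \<noteq> 0 \<longrightarrow> i + j = n)"

text \<open>The pair \<open>(f, g)\<close> stands for the derivation \<open>f \<partial>\<^sub>x + g \<partial>\<^sub>y\<close>.\<close>

type_synonym 'p der = "'p bipoly \<times> 'p bipoly"

definition der_apply :: "'p::prime_card der \<Rightarrow> 'p bipoly \<Rightarrow> 'p bipoly" where
  "der_apply \<theta> h = fst \<theta> * partial_x h + snd \<theta> * partial_y h"

lemma der_apply_var_x [simp]: "der_apply (f, g) var_x = f"
  by (simp add: der_apply_def partial_x_def partial_y_def var_x_def map_poly_pCons pderiv_pCons flip: one_pCons)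

lemma der_apply_var_y [simp]: "der_apply (f, g) var_y = g"
  by (simp add: der_apply_def partial_x_def partial_y_def var_y_def map_poly_pCons pderiv_pCons)

definition der_scale :: "'p::prime_card bipoly \<Rightarrow> 'p der \<Rightarrow> 'p der" where
  "der_scale s \<theta> = (s * fst \<theta>, s * snd \<theta>)"

interpretation Der: Modules.module der_scale
  by unfold_locales (auto simp: der_scale_def prod_eq_iff algebra_simps)

definition is_basis :: "'p::prime_card der set \<Rightarrow> 'p der set \<Rightarrow> bool" where
  "is_basis B M \<longleftrightarrow> Der.independent B \<and> Der.span B = M"

text \<open>The module \<open>D(A, \<mu>)\<close> for the arrangement with defining forms \<open>x\<close>, \<open>y\<close>, \<open>x + y\<close>.\<close>

definition mult_der :: "nat \<times> nat \<times> nat \<Rightarrow> 'p::prime_card der set" where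
  "mult_der = (\<lambda>(\<mu>1, \<mu>2, \<mu>3). {\<theta>.
     var_x ^ \<mu>1 dvd der_apply \<theta> var_x \<and>
     var_y ^ \<mu>2 dvd der_apply \<theta> var_y \<and>
     (var_x + var_y) ^ \<mu>3 dvd der_apply \<theta> (var_x + var_y)})"

text \<open>
  The degree of a homogeneous derivation is the polynomial degree of its coefficients, so
  \<open>\<partial>\<^sub>x\<close> and \<open>\<partial>\<^sub>y\<close> have degree 0.
\<close>

definition homogeneous_der :: "nat \<Rightarrow> 'p::prime_card der \<Rightarrow> bool" where
  "homogeneous_der n \<theta> \<longleftrightarrow> homogeneous n (fst \<theta>) \<and> homogeneous n (snd \<theta>)"

text \<open>
  \<open>e1\<close> and \<open>e2\<close> are the exponents, in some order.  The field cannot be read off from a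
  multiplicity, so it is passed as a type argument.  The set \<open>{\<theta>1, \<theta>2}\<close> is never a
  singleton here, since the module has rank 2.
\<close>

definition exponents :: "'p::prime_card itself \<Rightarrow> nat \<times> nat \<times> nat \<Rightarrow> nat \<Rightarrow> nat \<Rightarrow> bool" where
  "exponents _ \<mu> e1 e2 \<longleftrightarrow> (\<exists>\<theta>1 \<theta>2 :: 'p der.
     is_basis {\<theta>1, \<theta>2} (mult_der \<mu>) \<and> homogeneous_der e1 \<theta>1 \<and> homogeneous_der e2 \<theta>2)"

definition Delta :: "'p::prime_card itself \<Rightarrow> nat \<times> nat \<times> nat \<Rightarrow> int" where
  "Delta F \<mu> = (THE \<delta>. \<exists>e1 e2. exponents F \<mu> e1 e2 \<and> \<delta> = \<bar>int e1 - int e2\<bar>)"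

definition Psi :: "nat \<Rightarrow> 'p::prime_card der \<Rightarrow> 'p der" where
  "Psi d \<theta> = (der_apply \<theta> var_x * var_x ^ (CARD('p) ^ d),
              - (der_apply \<theta> var_y * var_y ^ (CARD('p) ^ d)))"

end

theory Submission
  imports Defs
begin

text \<open>
  With \<open>q = p\<^sup>d\<close>, the Frobenius identity \<open>x\<^sup>q + y\<^sup>q = (x + y)\<^sup>q\<close> gives
  \<open>f x\<^sup>q - g y\<^sup>q = f (x + y)\<^sup>q - (f + g) y\<^sup>q\<close>.  Since \<open>\<mu>\<^sub>3 \<le> q\<close> and \<open>y\<close> is coprime to
  \<open>x + y\<close>, the form \<open>(x + y)\<^bsup>\<mu>\<^sub>3\<^esup>\<close> divides this iff it divides \<open>f + g\<close>.  Hence \<open>\<Psi>\<^sub>d\<close>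
  restricts to an \<open>S\<close>-module isomorphism from \<open>D(A, \<mu>)\<close> onto \<open>D(A, \<mu> + (q, q, 0))\<close>, which raises
  degrees by \<open>q\<close>.
\<close>

text \<open>A nontrivial relation is carried along \<open>f\<close> with the same scalars;
  injectivity keeps distinct vectors of \<open>S\<close> distinct, so no coefficients merge and
  cancel. Together with \<open>independent_inj_image\<close>, this makes independence invariant
  under injective homomorphisms.\<close>

lemma (in module_hom) dependent_image_inj:
  assumes "inj f" and "m1.dependent S"
  shows "m2.dependent (f ` S)"
proof -
  obtain t u v where t: "finite t" "t \<subseteq> S" "(\<Sum>v\<in>t. s1 (u v) v) = 0" "v \<in> t" "u v \<noteq> 0"
    using assms(2) unfolding m1.dependent_explicit by blast
  have "(\<Sum>w\<in>f ` t. s2 (u (inv_into UNIV f w)) w) = (\<Sum>v\<in>t. f (s1 (u v) v))"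
    using assms(1) by (subst sum.reindex) (auto simp: scale intro: inj_on_subset)
  also have "\<dots> = 0"
    using t(3) by (simp add: zero flip: sum)
  finally show ?thesis
    unfolding m2.dependent_explicit using t assms(1)
    by (intro exI[of _ "f ` t"] exI[of _ "u \<circ> inv_into UNIV f"] conjI bexI[of _ "f v"]) auto
qed

lemma Psi_Pair [simp]:
  "Psi d (f, g :: 'p::prime_card bipoly) = (f * var_x ^ (CARD('p) ^ d), - (g * var_y ^ (CARD('p) ^ d)))"
  by (simp add: Psi_def)

lemma var_x_power: "(var_x :: 'p::prime_card bipoly) ^ n = [:monom 1 n:]"
  by (induction n) (auto simp: var_x_def monom_Suc one_pCons)

lemma var_y_power: "(var_y :: 'p::prime_card bipoly) ^ n = monom 1 n"
  by (simp add: var_y_def monom_altdef)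

lemma var_nonzero [simp]: "var_x \<noteq> 0" "var_y \<noteq> 0"
  by (auto simp: var_x_def var_y_def)

text \<open>A factor that does not vanish at \<open>a\<close> has order 0 there, so multiplying by
  it leaves the multiplicity of the root \<open>a\<close> unchanged. This supplies the coprimality
  of \<open>y\<close> and \<open>x + y\<close>.\<close>

lemma linear_power_dvd_mult_cancel:
  fixes a :: "'a::idom"
  assumes "poly r a \<noteq> 0"
  shows "[:-a, 1:] ^ n dvd p * r \<longleftrightarrow> [:-a, 1:] ^ n dvd p"
proof (cases "p = 0")
  case False
  moreover have "r \<noteq> 0"
    using assms by auto
  ultimately show ?thesis
    using order_0I[OF assms] by (simp add: order_divides order_mult)
qed simp

lemma var_sum_power_dvd_iff:
  fixes f g :: "'p::prime_card bipoly"
  assumes "m \<le> CARD('p) ^ d"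
  shows "(var_x + var_y) ^ m dvd f * var_x ^ (CARD('p) ^ d) - g * var_y ^ (CARD('p) ^ d) \<longleftrightarrow>
         (var_x + var_y) ^ m dvd f + g"
proof -
  let ?q = "CARD('p) ^ d" and ?z = "var_x + var_y :: 'p bipoly"
  have frob: "?z ^ ?q = var_x ^ ?q + var_y ^ ?q"
    by (rule freshmans_dream') (simp_all add: prime_card)
  \<comment> \<open>Over the coefficient ring \<open>F[x]\<close>, the form \<open>x + y\<close> is
    monic and linear in \<open>y\<close>, with root \<open>-x\<close>; a power of \<open>y\<close>
    takes a nonzero value at that root.\<close>
  have z: "?z = [:- [:0, -1:], 1:]"
    by (simp add: var_x_def var_y_def)
  have "f * var_x ^ ?q - g * var_y ^ ?q = f * ?z ^ ?q - (f + g) * var_y ^ ?q"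
    by (simp add: frob algebra_simps)
  moreover have "?z ^ m dvd f * ?z ^ ?q"
    using assms by (simp add: dvd_mult le_imp_power_dvd)
  ultimately have "?z ^ m dvd f * var_x ^ ?q - g * var_y ^ ?q \<longleftrightarrow> ?z ^ m dvd (f + g) * var_y ^ ?q"
    by (metis dvd_diff_right_iff)
  also have "\<dots> \<longleftrightarrow> ?z ^ m dvd f + g"
    unfolding z by (rule linear_power_dvd_mult_cancel) (simp add: var_y_def)
  finally show ?thesis .
qed

lemma mult_der_iff:
  "(f, g) \<in> mult_der (m1, m2, m3) \<longleftrightarrow>
     var_x ^ m1 dvd f \<and> var_y ^ m2 dvd g \<and> (var_x + var_y) ^ m3 dvd f + g"
proof -
  have "der_apply (f, g) (var_x + var_y) = der_apply (f, g) var_x + der_apply (f, g) var_y"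
    by (simp add: der_apply_def partial_x_def partial_y_def map_poly_add pderiv_add algebra_simps)
  then show ?thesis
    by (simp add: mult_der_def)
qed

lemma Psi_mem_mult_der_iff:
  fixes \<theta> :: "'p::prime_card der"
  assumes "m3 \<le> CARD('p) ^ d"
  shows "Psi d \<theta> \<in> mult_der (m1 + CARD('p) ^ d, m2 + CARD('p) ^ d, m3) \<longleftrightarrow>
         \<theta> \<in> mult_der (m1, m2, m3)"
  using var_sum_power_dvd_iff[OF assms] by (cases \<theta>) (simp add: mult_der_iff power_add)

lemma Psi_image_mult_der:
  assumes "m3 \<le> CARD('p::prime_card) ^ d"
  shows "Psi d ` (mult_der (m1, m2, m3) :: 'p der set) =
         mult_der (m1 + CARD('p) ^ d, m2 + CARD('p) ^ d, m3)" (is "_ = ?M")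
proof (intro equalityI subsetI)
  fix \<eta> :: "'p der"
  assume \<eta>: "\<eta> \<in> ?M"
  obtain f g where fg: "\<eta> = (f, g)"
    by (cases \<eta>)
  then obtain a b where "f = var_x ^ (m1 + CARD('p) ^ d) * a" "g = var_y ^ (m2 + CARD('p) ^ d) * b"
    using \<eta> by (auto simp: mult_der_iff elim!: dvdE)
  \<comment> \<open>The preimage divides out \<open>x^q\<close> and \<open>y^q\<close>, where
    \<open>q = p^d\<close>; its minus sign undoes the one in \<open>Psi\<close>. That it lies in the
    source module follows from \<open>Psi_mem_mult_der_iff\<close>.\<close>
  then have "\<eta> = Psi d (var_x ^ m1 * a, - (var_y ^ m2 * b))"
    by (simp add: fg power_add mult_ac)
  then show "\<eta> \<in> Psi d ` mult_der (m1, m2, m3)"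
    using \<eta> Psi_mem_mult_der_iff[OF assms] by blast
qed (auto simp: Psi_mem_mult_der_iff[OF assms] simp del: Psi_Pair)

lemma inj_Psi: "inj (Psi d :: 'p::prime_card der \<Rightarrow> 'p der)"
  by (rule injI) auto

interpretation Psi: module_hom der_scale der_scale "Psi d :: 'p::prime_card der \<Rightarrow> 'p der" for d
  by unfold_locales (auto simp: der_scale_def prod_eq_iff algebra_simps Psi_def der_apply_def)

lemma is_basis_Psi_image_iff: "is_basis (Psi d ` B) (Psi d ` M) \<longleftrightarrow> is_basis B M"
  unfolding is_basis_def Psi.span_image inj_image_eq_iff[OF inj_Psi]
  using Psi.dependent_image_inj[OF inj_Psi] Psi.independent_inj_image[OF _ inj_Psi] by blast

lemma homogeneous_minus [simp]: "homogeneous n (- h) \<longleftrightarrow> homogeneous n h"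
  by (simp add: homogeneous_def)

text \<open>The shift is written as \<open>i + j + k = n\<close> because
  \<open>homogeneous (n - k) h\<close> would be wrong under truncated subtraction: for
  \<open>h = 1\<close>, \<open>n = 0\<close> and \<open>k > 0\<close> it holds, although
  \<open>x^k\<close> is not homogeneous of degree 0.\<close>

lemma homogeneous_mult_var_x_power:
  "homogeneous n (h * var_x ^ k) \<longleftrightarrow> (\<forall>i j. coeff (coeff h j) i \<noteq> 0 \<longrightarrow> i + j + k = n)"
proof -
  have c: "coeff (coeff (h * var_x ^ k) j) i = (if i < k then 0 else coeff (coeff h j) (i - k))" for i j
    by (simp add: var_x_power mult.commute[of h] coeff_monom_mult)
  show ?thesis
    unfolding homogeneous_def c
  proof (intro iffI allI impI)
    fix i j
    assume *: "\<forall>i j. (if i < k then 0 else coeff (coeff h j) (i - k)) \<noteq> 0 \<longrightarrow> i + j = n"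
      and "coeff (coeff h j) i \<noteq> 0"
    then show "i + j + k = n"
      using spec[OF spec[OF *, of "i + k"], of j] by (simp add: ac_simps)
  next
    fix i j
    assume *: "\<forall>i j. coeff (coeff h j) i \<noteq> 0 \<longrightarrow> i + j + k = n"
      and nz: "(if i < k then 0 else coeff (coeff h j) (i - k)) \<noteq> 0"
    show "i + j = n"
      using nz spec[OF spec[OF *, of "i - k"], of j] by (auto split: if_splits)
  qed
qed

lemma homogeneous_mult_var_y_power:
  "homogeneous n (h * var_y ^ k) \<longleftrightarrow> (\<forall>i j. coeff (coeff h j) i \<noteq> 0 \<longrightarrow> i + j + k = n)"
proof -
  have c: "coeff (coeff (h * var_y ^ k) j) i = (if j < k then 0 else coeff (coeff h (j - k)) i)" for i j
    by (simp add: var_y_power mult.commute[of h] coeff_monom_mult)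
  show ?thesis
    unfolding homogeneous_def c
  proof (intro iffI allI impI)
    fix i j
    assume *: "\<forall>i j. (if j < k then 0 else coeff (coeff h (j - k)) i) \<noteq> 0 \<longrightarrow> i + j = n"
      and "coeff (coeff h j) i \<noteq> 0"
    then show "i + j + k = n"
      using spec[OF spec[OF *, of i], of "j + k"] by (simp add: ac_simps)
  next
    fix i j
    assume *: "\<forall>i j. coeff (coeff h j) i \<noteq> 0 \<longrightarrow> i + j + k = n"
      and nz: "(if j < k then 0 else coeff (coeff h (j - k)) i) \<noteq> 0"
    show "i + j = n"
      using nz spec[OF spec[OF *, of i], of "j - k"] by (auto split: if_splits)
  qed
qed

text \<open>The zero derivation is homogeneous of every degree, even below \<open>p^d\<close>. For
  \<theta> nonzero, some coefficient is nonzero and forces \<open>n\<close> to be at least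
  \<open>p^d\<close>, so that \<open>m\<close> exists.\<close>

lemma homogeneous_der_Psi_iff:
  fixes \<theta> :: "'p::prime_card der"
  assumes "\<theta> \<noteq> 0"
  shows "homogeneous_der n (Psi d \<theta>) \<longleftrightarrow>
         (\<exists>m. n = m + CARD('p) ^ d \<and> homogeneous_der m \<theta>)"
proof -
  obtain f g where fg: "\<theta> = (f, g)"
    by (cases \<theta>)
  \<comment> \<open>\<open>P\<close> expresses homogeneity of the image through the coefficients of
    \<theta> itself, so that both sides of the equivalence become instances of
    \<open>P\<close>.\<close>
  define P where "P m \<longleftrightarrow> (\<forall>i j. (coeff (coeff f j) i \<noteq> 0 \<longrightarrow> i + j + CARD('p) ^ d = m) \<and>
    (coeff (coeff g j) i \<noteq> 0 \<longrightarrow> i + j + CARD('p) ^ d = m))" for m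
  have Psi: "homogeneous_der n (Psi d \<theta>) \<longleftrightarrow> P n"
    by (auto simp: fg P_def homogeneous_der_def homogeneous_mult_var_x_power homogeneous_mult_var_y_power)
  have shift: "homogeneous_der m \<theta> \<longleftrightarrow> P (m + CARD('p) ^ d)" for m
    by (auto simp: fg P_def homogeneous_der_def homogeneous_def)
  obtain i j where "coeff (coeff f j) i \<noteq> 0 \<or> coeff (coeff g j) i \<noteq> 0"
    using assms by (auto simp: fg prod_eq_iff poly_eq_iff)
  then have "CARD('p) ^ d \<le> n" if "P n"
    using that le_add2 unfolding P_def by blast
  then show ?thesis
    unfolding Psi shift by (metis le_add_diff_inverse2)
qed

lemma exponents_shift_iff:
  fixes F :: "'p::prime_card itself"
  assumes "m3 \<le> CARD('p) ^ d"
  defines "q \<equiv> CARD('p) ^ d"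
  shows "exponents F (m1 + q, m2 + q, m3) n n' \<longleftrightarrow>
    (\<exists>e e'. n = e + q \<and> n' = e' + q \<and> exponents F (m1, m2, m3) e e')"
proof -
  let ?M = "mult_der (m1, m2, m3) :: 'p der set"
  have basis: "is_basis {Psi d \<theta>, Psi d \<theta>'} (Psi d ` ?M) \<longleftrightarrow> is_basis {\<theta>, \<theta>'} ?M" for \<theta> \<theta>' :: "'p der"
    using is_basis_Psi_image_iff[of d "{\<theta>, \<theta>'}"] by simp
  have nz: "\<theta> \<noteq> 0" "\<theta>' \<noteq> 0" if "is_basis {\<theta>, \<theta>'} ?M" for \<theta> \<theta>' :: "'p der"
    using that Der.dependent_zero[of "{\<theta>, \<theta>'}"] unfolding is_basis_def by auto
  have M: "mult_der (m1 + q, m2 + q, m3) = Psi d ` ?M"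
    using Psi_image_mult_der[OF assms(1)] by (simp add: q_def)
  \<comment> \<open>A basis of the image module lies inside it, so it is the image of a pair, which
    is then a basis of \<open>?M\<close>. The predicate \<open>R\<close> will be homogeneity in the
    degrees \<open>n\<close> and \<open>n'\<close>.\<close>
  have ex: "(\<exists>\<eta> \<eta>'. is_basis {\<eta>, \<eta>'} (Psi d ` ?M) \<and> R \<eta> \<eta>') \<longleftrightarrow>
      (\<exists>\<theta> \<theta>'. is_basis {\<theta>, \<theta>'} ?M \<and> R (Psi d \<theta>) (Psi d \<theta>'))" for R
  proof
    assume "\<exists>\<eta> \<eta>'. is_basis {\<eta>, \<eta>'} (Psi d ` ?M) \<and> R \<eta> \<eta>'"
    then obtain \<eta> \<eta>' where *: "is_basis {\<eta>, \<eta>'} (Psi d ` ?M)" "R \<eta> \<eta>'"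
      by blast
    then have "\<eta> \<in> Psi d ` ?M" "\<eta>' \<in> Psi d ` ?M"
      using Der.span_superset[of "{\<eta>, \<eta>'}"] unfolding is_basis_def by auto
    then obtain \<theta> \<theta>' where "\<eta> = Psi d \<theta>" "\<eta>' = Psi d \<theta>'"
      by blast
    then show "\<exists>\<theta> \<theta>'. is_basis {\<theta>, \<theta>'} ?M \<and> R (Psi d \<theta>) (Psi d \<theta>')"
      using * basis by blast
  qed (use basis in blast)
  have deg: "is_basis {\<theta>, \<theta>'} ?M \<and> homogeneous_der n (Psi d \<theta>) \<and> homogeneous_der n' (Psi d \<theta>') \<longleftrightarrow>
      (\<exists>e e'. n = e + q \<and> n' = e' + q \<and>
        is_basis {\<theta>, \<theta>'} ?M \<and> homogeneous_der e \<theta> \<and> homogeneous_der e' \<theta>')" for \<theta> \<theta>'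
    using nz[of \<theta> \<theta>'] by (auto simp: homogeneous_der_Psi_iff q_def simp del: Psi_Pair)
  show ?thesis
    unfolding exponents_def M ex deg by blast
qed

theorem theorem4p2:
  fixes \<mu>1 \<mu>2 \<mu>3 d p :: nat
  assumes "p = CARD('p::prime_card)"
    and "d > 0"
    and "\<mu>3 \<le> p ^ d"
  shows "(\<forall>\<theta> \<theta>' :: 'p der.
            is_basis {\<theta>, \<theta>'} (mult_der (\<mu>1, \<mu>2, \<mu>3)) \<longleftrightarrow>
            is_basis {Psi d \<theta>, Psi d \<theta>'} (mult_der ((\<mu>1, \<mu>2, \<mu>3) + (p ^ d, p ^ d, 0)))) \<and>
         Delta TYPE('p) (\<mu>1, \<mu>2, \<mu>3) = Delta TYPE('p) ((\<mu>1, \<mu>2, \<mu>3) + (p ^ d, p ^ d, 0))"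
proof -
  have le: "\<mu>3 \<le> CARD('p) ^ d"
    using assms by simp
  \<comment> \<open>Both exponents rise by the same amount, which cancels in the difference. The
    predicates under \<open>THE\<close> thus agree at every \<delta>, and so do the two values of
    \<open>Delta\<close>.\<close>
  have "(\<exists>n n'. exponents TYPE('p) (\<mu>1 + p ^ d, \<mu>2 + p ^ d, \<mu>3) n n' \<and> \<delta> = \<bar>int n - int n'\<bar>) \<longleftrightarrow>
        (\<exists>e e'. exponents TYPE('p) (\<mu>1, \<mu>2, \<mu>3) e e' \<and> \<delta> = \<bar>int e - int e'\<bar>)" for \<delta>
    unfolding assms(1) exponents_shift_iff[OF le] by force
  then have "Delta TYPE('p) (\<mu>1, \<mu>2, \<mu>3) = Delta TYPE('p) (\<mu>1 + p ^ d, \<mu>2 + p ^ d, \<mu>3)"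
    by (simp add: Delta_def)
  moreover have "is_basis {\<theta>, \<theta>'} (mult_der (\<mu>1, \<mu>2, \<mu>3)) \<longleftrightarrow>
      is_basis {Psi d \<theta>, Psi d \<theta>'} (mult_der (\<mu>1 + p ^ d, \<mu>2 + p ^ d, \<mu>3))" for \<theta> \<theta>' :: "'p der"
    using is_basis_Psi_image_iff[of d "{\<theta>, \<theta>'}" "mult_der (\<mu>1, \<mu>2, \<mu>3)"]
    by (simp add: Psi_image_mult_der[OF le] assms(1))
  ultimately show ?thesis
    by simp
qed

end
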